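(* There exists an infinite sequence $X=(\vec x_i)_{i=1}^\infty$ of nonzero points in $[0,1]^2$ such that $\mathrm{AlignGap}(X)\le 6$ but $\mathrm{MenuGap}(X)=\infty$.
   Context: MenuGap: Let $X=(\vec x_i)_{i=1}^N$ be an ordered sequence of nonzero points of $\mathbb{R}^k_{\ge0}$ ($N$ finite or $+\infty$), and $Q=(\vec q_i)_{i=0}^N$ an ordered sequence of points of $[0,1]^k$ with $\vec q_0=(0,\dots,0)$. Define $\mathrm{gap}_i^{X,Q}:=\min_{0\le j<i}(\vec q_i-\vec q_j)\cdot\vec x_i$ and $\mathrm{MenuGap}(X,Q):=\sum_{i=1}^N \mathrm{gap}_i^{X,Q}/\|\vec x_i\|_1$, and $\mathrm{MenuGap}(X):=\sup_Q \mathrm{MenuGap}(X,Q)$. AlignGap: For $X=(\vec x_i)_{i=1}^N$ a sequence of nonzero points in $[0,1]^k$, let $C=(c_i)_{i=0}^N$ be a sequence of reals with $c_0=0$ and $c_i\in[0,1/\|\vec x_i\|_\infty]$ for $i\ge1$; set $\vec x_0:=\vec 0$. Define $\mathrm{sgap}_i^{X,C}:=\min_{0\le j<i}\vec x_i\cdot(c_i\vec x_i-c_j\vec x_j)$, $\mathrm{AlignGap}(X,C):=\sum_{i=1}^N \max\{0,\mathrm{sgap}_i^{X,C}\}/\|\vec x_i\|_1$, and $\mathrm{AlignGap}(X):=\sup_C\mathrm{AlignGap}(X,C)$. *)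

theory Defs
  imports "HOL-Analysis.Analysis"
begin

text \<open>Points of R^k are vectors real^'n with 'n a finite index type (k = CARD('n)).
  Sequences are indexed by nat; the entries X i for i >= 1 are the points x_1, x_2, ...;
  the value X 0 is ignored (the paper's x_0 := 0 is hard-wired below).
  Infinite sums are taken in the extended reals as liminf of the partial sums.\<close>

definition l1norm :: "real^'n \<Rightarrow> real" where
  "l1norm x = (\<Sum>k\<in>UNIV. \<bar>x $ k\<bar>)"

definition linfnorm :: "real^'n \<Rightarrow> real" where
  "linfnorm x = Max (range (\<lambda>k. \<bar>x $ k\<bar>))"

definition menus :: "(nat \<Rightarrow> real^'n) set" where
  "menus = {Q. Q 0 = 0 \<and> (\<forall>i\<ge>1. \<forall>k. 0 \<le> Q i $ k \<and> Q i $ k \<le> 1)}"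

definition menu_gap_i :: "(nat \<Rightarrow> real^'n) \<Rightarrow> (nat \<Rightarrow> real^'n) \<Rightarrow> nat \<Rightarrow> real" where
  "menu_gap_i X Q i = Min ((\<lambda>j. (Q i - Q j) \<bullet> X i) ` {..<i})"

definition MenuGapQ :: "(nat \<Rightarrow> real^'n) \<Rightarrow> (nat \<Rightarrow> real^'n) \<Rightarrow> ereal" where
  "MenuGapQ X Q = liminf (\<lambda>n. ereal (\<Sum>i\<in>{1..n}. menu_gap_i X Q i / l1norm (X i)))"

definition MenuGap :: "(nat \<Rightarrow> real^'n) \<Rightarrow> ereal" where
  "MenuGap X = (SUP Q\<in>menus. MenuGapQ X Q)"

definition xz :: "(nat \<Rightarrow> real^'n) \<Rightarrow> nat \<Rightarrow> real^'n" where
  "xz X j = (if j = 0 then 0 else X j)"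

definition aligns :: "(nat \<Rightarrow> real^'n) \<Rightarrow> (nat \<Rightarrow> real) set" where
  "aligns X = {C. C 0 = 0 \<and> (\<forall>i\<ge>1. 0 \<le> C i \<and> C i \<le> 1 / linfnorm (X i))}"

definition sgap_i :: "(nat \<Rightarrow> real^'n) \<Rightarrow> (nat \<Rightarrow> real) \<Rightarrow> nat \<Rightarrow> real" where
  "sgap_i X C i = Min ((\<lambda>j. X i \<bullet> (C i *\<^sub>R X i - C j *\<^sub>R xz X j)) ` {..<i})"

definition AlignGapC :: "(nat \<Rightarrow> real^'n) \<Rightarrow> (nat \<Rightarrow> real) \<Rightarrow> ereal" where
  "AlignGapC X C = liminf (\<lambda>n. ereal (\<Sum>i\<in>{1..n}. max 0 (sgap_i X C i) / l1norm (X i)))"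

definition AlignGap :: "(nat \<Rightarrow> real^'n) \<Rightarrow> ereal" where
  "AlignGap X = (SUP C\<in>aligns X. AlignGapC X C)"

end

theory Submission
  imports Defs
begin

text \<open>All points are normals $(a_i, 1)$. They come in blocks along which $a_i$ increases
  from $w/K$ to $w$ in steps of $w/K$, with $w$ of order $K^{-2}$; there are about $K^3$ consecutive
  blocks with the same $K = 2^m$.

  For the menu, a block is placed along the parabola $y = h - w x^2 / 2$ over $[0,1]$, the entry
  with normal $(w x, 1)$ at abscissa $x$. Every point gains about $w K^{-2}$, since the gap to a
  point at abscissa $x'$ of the same block is $w (x - x')^2 / 2$, while $h$ need only grow
  by $w K^{-2}$ from block to block. So a level $m$ contributes a constant at the cost of
  $2^{-m}$ in height.

  Aligned entries $c_i (a_i, 1)$ cannot exploit the length of the parabola: if $j < i$ are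
  consecutive indices with positive gap, the gap at $i$ is at most
  $c_i (1 + a_i^2) - c_j (1 + a_j^2) + c_j a_j (a_j - a_i)$. The first part telescopes and the
  second is positive only when a block is left, where it is at most $w^2$, which is summable
  over all blocks.\<close>

section \<open>Normals \<open>(a, 1)\<close> and their norms\<close>

definition slope_vec :: "real \<Rightarrow> real^2" where
  "slope_vec a = vector [a, 1]"

lemma slope_vec_nth [simp]: "slope_vec a $ 1 = a" "slope_vec a $ 2 = 1"
  by (simp_all add: slope_vec_def)

lemma slope_vec_neq_0 [simp]: "slope_vec a \<noteq> 0"
  by (metis slope_vec_nth(2) zero_index zero_neq_one)

lemma inner_real2: "(x :: real^2) \<bullet> y = x $ 1 * y $ 1 + x $ 2 * y $ 2"
  by (simp add: inner_vec_def sum_2)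

lemma l1norm_slope_vec: "a \<ge> 0 \<Longrightarrow> l1norm (slope_vec a) = 1 + a"
  by (simp add: l1norm_def sum_2)

lemma linfnorm_slope_vec: "0 \<le> a \<Longrightarrow> a \<le> 1 \<Longrightarrow> linfnorm (slope_vec a) = 1"
proof -
  assume a: "0 \<le> a" "a \<le> 1"
  have "range (\<lambda>k. \<bar>slope_vec a $ k\<bar>) = {\<bar>a\<bar>, 1}"
    by (auto simp: UNIV_2)
  then show ?thesis
    using a by (simp add: linfnorm_def)
qed

lemma aligns_slope_vec_bounds:
  assumes "\<And>i. 0 \<le> a i" "\<And>i. a i \<le> 1" "C \<in> aligns (\<lambda>i. slope_vec (a i))"
  shows "0 \<le> C i \<and> C i \<le> 1"
  using assms by (cases "i = 0") (auto simp: aligns_def linfnorm_slope_vec)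

section \<open>Alignment gap of a sequence of normals\<close>

text \<open>Induction on \<open>n\<close>, where \<open>l\<close> is the last index of positive gap
  so far, or 0. Testing the next such gap against \<open>l\<close> alone makes the sum telescope, up
  to a surplus that is positive only if the slope drops; the potential \<open>W\<close> pays for
  it.\<close>

lemma sum_max_sgap_le:
  fixes a W :: "nat \<Rightarrow> real"
  assumes a: "\<And>i. 0 \<le> a i" "\<And>i. a i \<le> 1"
    and W: "\<And>i. 0 \<le> W i" "mono W"
    and descent: "\<And>l i. l < i \<Longrightarrow> a i < a l \<Longrightarrow> (a l)\<^sup>2 + W l \<le> W i"
    and C: "C \<in> aligns (\<lambda>i. slope_vec (a i))"
  defines "X \<equiv> \<lambda>i. slope_vec (a i)"
  shows "\<exists>l\<le>n. (\<Sum>i\<in>{1..n}. max 0 (sgap_i X C i) / l1norm (X i)) \<le> C l * (1 + (a l)\<^sup>2) + W l"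
proof (induction n)
  case 0
  then show ?case
    using W(1)[of 0] C by (simp add: aligns_def)
next
  case (Suc n)
  let ?i = "Suc n"
  obtain l where l: "l \<le> n"
    and S: "(\<Sum>i\<in>{1..n}. max 0 (sgap_i X C i) / l1norm (X i)) \<le> C l * (1 + (a l)\<^sup>2) + W l"
    using Suc by blast
  have C0: "C 0 = 0"
    using C by (simp add: aligns_def)
  note C1 = aligns_slope_vec_bounds[OF a C]
  show ?case
  proof (cases "sgap_i X C ?i \<le> 0")
    case True
    then have "max 0 (sgap_i X C ?i) = 0" by simp
    then show ?thesis
      using S l by (intro exI[of _ l]) simp
  next
    case False
    have "max 0 (sgap_i X C ?i) / l1norm (X ?i) \<le> sgap_i X C ?i"
      using False a(1)[of ?i] by (simp add: X_def l1norm_slope_vec divide_le_eq mult_le_cancel_left1)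
    also have "\<dots> \<le> X ?i \<bullet> (C ?i *\<^sub>R X ?i - C l *\<^sub>R xz X l)"
      unfolding sgap_i_def using l by (intro Min_le) auto
    \<comment> \<open>For \<open>l = 0\<close>, \<open>xz\<close> puts the zero vector in place of
      \<open>X 0\<close>; the formula persists because \<open>C 0 = 0\<close>.\<close>
    also have "\<dots> = C ?i * (1 + (a ?i)\<^sup>2) - C l * (1 + a ?i * a l)"
      using C0 by (cases "l = 0") (simp_all add: X_def xz_def inner_real2 power2_eq_square algebra_simps)
    also have "\<dots> = C ?i * (1 + (a ?i)\<^sup>2) - C l * (1 + (a l)\<^sup>2) + C l * (a l * (a l - a ?i))"
      by (simp add: power2_eq_square algebra_simps)
    also have "\<dots> \<le> C ?i * (1 + (a ?i)\<^sup>2) - C l * (1 + (a l)\<^sup>2) + (W ?i - W l)"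
    proof -
      have "C l * (a l * (a l - a ?i)) \<le> W ?i - W l"
      proof (cases "a ?i < a l")
        case True
        have "C l * (a l * (a l - a ?i)) \<le> 1 * (a l * a l)"
          using True C1[of l] a(1) by (intro mult_mono) auto
        also have "\<dots> \<le> W ?i - W l"
          using descent[of l ?i] True l by (simp add: power2_eq_square)
        finally show ?thesis .
      next
        case False
        then have "C l * (a l * (a l - a ?i)) \<le> 0"
          using C1[of l] a(1)[of l] by (simp add: mult_nonneg_nonpos)
        also have "0 \<le> W ?i - W l"
          using W(2) l by (simp add: monoD)
        finally show ?thesis .
      qed
      then show ?thesis by simp
    qed
    finally show ?thesis
      using S by (intro exI[of _ ?i]) simp
  qed
qed

lemma AlignGap_slope_vec_le:
  fixes a W :: "nat \<Rightarrow> real"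
  assumes a: "\<And>i. 0 \<le> a i" "\<And>i. a i \<le> 1"
    and W: "\<And>i. 0 \<le> W i" "\<And>i. W i \<le> B" "mono W"
    and descent: "\<And>l i. l < i \<Longrightarrow> a i < a l \<Longrightarrow> (a l)\<^sup>2 + W l \<le> W i"
  shows "AlignGap (\<lambda>i. slope_vec (a i)) \<le> ereal (2 + B)"
  unfolding AlignGap_def
proof (rule SUP_least)
  let ?X = "\<lambda>i. slope_vec (a i)"
  fix C assume C: "C \<in> aligns ?X"
  have "(\<Sum>i\<in>{1..n}. max 0 (sgap_i ?X C i) / l1norm (?X i)) \<le> 2 + B" for n
  proof -
    obtain l where l: "(\<Sum>i\<in>{1..n}. max 0 (sgap_i ?X C i) / l1norm (?X i))
        \<le> C l * (1 + (a l)\<^sup>2) + W l"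
      using sum_max_sgap_le[OF a W(1) W(3) descent C] by blast
    have "C l * (1 + (a l)\<^sup>2) \<le> 1 * (1 + 1)"
      using a[of l] aligns_slope_vec_bounds[OF a C, of l]
      by (intro mult_mono add_mono) (auto simp: power_le_one)
    then show ?thesis
      using l W(2)[of l] by simp
  qed
  then have "limsup (\<lambda>n. ereal (\<Sum>i\<in>{1..n}. max 0 (sgap_i ?X C i) / l1norm (?X i))) \<le> ereal (2 + B)"
    by (intro Limsup_bounded) auto
  then show "AlignGapC ?X C \<le> ereal (2 + B)"
    unfolding AlignGapC_def using Liminf_le_Limsup order_trans trivial_limit_sequentially by blast
qed

section \<open>Infinite menu gap by comparison with the harmonic series\<close>

lemma MenuGap_eq_PInfty:
  assumes Q: "Q \<in> menus" and "c > 0"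
    and gap: "\<And>i. i \<ge> 1 \<Longrightarrow> c / real i \<le> menu_gap_i X Q i / l1norm (X i)"
  shows "MenuGap X = \<infinity>"
proof -
  let ?S = "\<lambda>n. \<Sum>i\<in>{1..n}. menu_gap_i X Q i / l1norm (X i)"
  have "c * harm n \<le> ?S n" for n
    unfolding harm_def sum_distrib_left
    using gap by (intro sum_mono) (auto simp: divide_inverse)
  moreover have "filterlim (\<lambda>n. c * harm n) at_top sequentially"
    using \<open>c > 0\<close> harm_at_top by (intro filterlim_tendsto_pos_mult_at_top[OF tendsto_const]) auto
  ultimately have "filterlim ?S at_top sequentially"
    using filterlim_at_top_mono by (metis (no_types, lifting) always_eventually)
  then have "(\<lambda>n. ereal (?S n)) \<longlonglongrightarrow> \<infinity>"
    by (simp add: tendsto_PInfty_eq_at_top)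
  then have "MenuGapQ X Q = \<infinity>"
    unfolding MenuGapQ_def by (intro lim_imp_Liminf) auto
  then show ?thesis
    using Q unfolding MenuGap_def by (metis SUP_upper ereal_infty_less_eq(1))
qed

section \<open>Levels and the accumulated height\<close>

text \<open>For \<open>i >= 1\<close> this is the integer part of the logarithm to base 16; index 0
  joins level 0. Gaps at level m are of order \<open>1 / 16 ^ m\<close>, so base 16 makes them
  comparable to \<open>1 / i\<close>.\<close>

definition level :: "nat \<Rightarrow> nat" where
  "level i = (LEAST m. i < 16 ^ Suc m)"

lemma less_power_Suc_level: "i < 16 ^ Suc (level i)"
proof -
  have "i < 2 ^ i" by (rule less_exp)
  also have "(2::nat) ^ i \<le> 16 ^ i" by (intro power_mono) auto
  also have "(16::nat) ^ i \<le> 16 ^ Suc i" by simp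
  finally have "i < 16 ^ Suc i" .
  then show ?thesis
    unfolding level_def by (rule LeastI)
qed

lemma level_le_iff: "level i \<le> m \<longleftrightarrow> i < 16 ^ Suc m"
proof
  assume "level i \<le> m"
  then have "(16::nat) ^ Suc (level i) \<le> 16 ^ Suc m"
    by (intro power_increasing) auto
  then show "i < 16 ^ Suc m"
    using less_power_Suc_level[of i] by linarith
next
  assume "i < 16 ^ Suc m"
  then show "level i \<le> m"
    unfolding level_def by (rule Least_le)
qed

lemma power_level_le:
  assumes "i \<ge> 1"
  shows "16 ^ level i \<le> i"
proof (cases "level i")
  case (Suc m)
  then have "\<not> level i \<le> m" by simp
  then show ?thesis
    unfolding level_le_iff using Suc by simp
qed (use assms in simp)

lemma level_eqI:
  assumes "16 ^ m \<le> i" "i < 16 ^ Suc m"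
  shows "level i = m"
proof (rule antisym)
  show "level i \<le> m"
    using assms(2) by (simp add: level_le_iff)
  show "m \<le> level i"
  proof (cases m)
    case (Suc k)
    then have "\<not> level i \<le> k"
      using assms(1) by (simp add: level_le_iff)
    then show ?thesis using Suc by simp
  qed simp
qed

lemma level_mono: "i \<le> j \<Longrightarrow> level i \<le> level j"
  using less_power_Suc_level[of j] by (simp add: level_le_iff)

text \<open>Accumulates a total of $16^{-m} = 2^m \cdot 32^{-m}$ over each block of level $m$.\<close>

definition rise :: "nat \<Rightarrow> real" where
  "rise i = (\<Sum>t<i. 1 / 32 ^ level t)"

lemma rise_mono: "i \<le> j \<Longrightarrow> rise i \<le> rise j"
  unfolding rise_def by (intro sum_mono2) auto

lemma rise_nonneg: "0 \<le> rise i"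
  unfolding rise_def by (intro sum_nonneg) auto

text \<open>The subtracted term makes the induction telescope: level \<open>M\<close> has
  \<open>15 * 16 ^ M\<close> indices and contributes \<open>15 / 2 ^ M\<close>, which is
  \<open>30 / 2 ^ M - 30 / 2 ^ Suc M\<close>.\<close>

lemma rise_power_le: "rise (16 ^ M) \<le> 32 - 30 / 2 ^ M"
proof (induction M)
  case 0
  have "level 0 = 0"
    by (metis level_le_iff le_zero_eq zero_less_numeral zero_less_power)
  then show ?case by (simp add: rise_def)
next
  case (Suc M)
  have "rise (16 ^ Suc M) = rise (16 ^ M) + (\<Sum>t = 16 ^ M..<16 ^ Suc M. 1 / 32 ^ level t)"
    unfolding rise_def lessThan_atLeast0
    by (rule sum.atLeastLessThan_concat[symmetric]) auto
  also have "(\<Sum>t = 16 ^ M..<16 ^ Suc M. 1 / 32 ^ level t)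
      = (\<Sum>t = (16::nat) ^ M..<16 ^ Suc M. 1 / (32::real) ^ M)"
  proof (rule sum.cong)
    fix t :: nat assume "t \<in> {16 ^ M..<16 ^ Suc M}"
    then have "level t = M" by (intro level_eqI) auto
    then show "1 / 32 ^ level t = 1 / (32::real) ^ M" by simp
  qed simp
  also have "\<dots> = 15 * (16 ^ M / 32 ^ M)"
    by (simp add: of_nat_diff)
  also have "16 ^ M / 32 ^ M = 1 / (2::real) ^ M"
    by (simp add: power_divide[symmetric]) (simp add: power_divide)
  finally show ?case
    using Suc by (simp add: field_simps)
qed

lemma rise_le: "rise i \<le> 32"
proof -
  have "i \<le> 16 ^ i"
    using less_exp[of i] power_mono[of 2 "16::nat" i] by linarith
  then have "rise i \<le> rise (16 ^ i)"
    by (rule rise_mono)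
  also have "\<dots> \<le> 32"
    using rise_power_le[of i] by (smt (verit) divide_nonneg_pos zero_less_power)
  finally show ?thesis .
qed

lemma rise_diff_ge:
  assumes "j + 2 ^ m \<le> i" "i \<le> 16 ^ Suc m"
  shows "1 / 16 ^ m \<le> rise i - rise j"
proof -
  have "1 / 16 ^ m = (\<Sum>t\<in>{j..<j + 2 ^ m}. 1 / (32::real) ^ m)"
    by (simp add: power_divide[symmetric] power_mult_distrib[symmetric] field_simps)
  also have "\<dots> \<le> (\<Sum>t\<in>{j..<j + 2 ^ m}. 1 / 32 ^ level t)"
    using assms by (intro sum_mono divide_left_mono power_increasing) (auto simp: level_le_iff)
  also have "\<dots> = rise (j + 2 ^ m) - rise j"
    unfolding rise_def by (simp add: sum_diff_nat_ivl[of 0 j, symmetric] atLeast0LessThan)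
  also have "\<dots> \<le> rise i - rise j"
    using rise_mono assms by simp
  finally show ?thesis .
qed

section \<open>Blocks, parabolas and the menu\<close>

definition block_start :: "nat \<Rightarrow> nat" where
  "block_start i = i - i mod 2 ^ level i"

text \<open>The offset 1 keeps abscissas away from 0; the comparison of entries across levels relies
  on this.\<close>

definition absc :: "nat \<Rightarrow> real" where
  "absc i = real (i mod 2 ^ level i + 1) / 2 ^ level i"

definition curv :: "nat \<Rightarrow> real" where
  "curv i = 1 / (64 * 4 ^ level i)"

definition slope :: "nat \<Rightarrow> real" where
  "slope i = curv i * absc i"

text \<open>The height grows with every index, also inside a block, which only enlarges gaps. As
  \<open>rise\<close> is at most 32, its share is at most 1/2; the other 1/2 keeps the coordinate
  nonnegative and separates all entries from the origin.\<close>

definition menu :: "nat \<Rightarrow> real^2" where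
  "menu i = (if i = 0 then 0
     else vector [absc i, 1/2 + rise i / 64 - curv i * (absc i)\<^sup>2 / 2])"

lemma absc_ge: "1 / 2 ^ level i \<le> absc i"
  unfolding absc_def by (intro divide_right_mono) auto

lemma absc_pos: "0 < absc i"
  unfolding absc_def by simp

lemma absc_le_1: "absc i \<le> 1"
proof -
  have "i mod 2 ^ level i + 1 \<le> 2 ^ level i"
    by (simp add: Suc_leI)
  then have "real (i mod 2 ^ level i + 1) \<le> 2 ^ level i"
    by (metis of_nat_le_iff of_nat_numeral of_nat_power)
  then show ?thesis by (simp add: absc_def)
qed

lemma curv_pos: "0 < curv i"
  by (simp add: curv_def)

lemma curv_le: "curv i \<le> 1 / 64"
  by (simp add: curv_def field_simps)

lemma slope_nonneg: "0 \<le> slope i"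
  using curv_pos absc_pos by (simp add: slope_def less_imp_le)

lemma slope_le_curv: "slope i \<le> curv i"
  using curv_pos absc_le_1 by (simp add: slope_def mult_le_cancel_left1)

lemma slope_le_1: "slope i \<le> 1"
  using slope_le_curv[of i] curv_le[of i] by linarith

lemma curv_sq: "(curv i)\<^sup>2 = 1 / (64\<^sup>2 * 16 ^ level i)"
  by (simp add: curv_def power2_eq_square power_mult_distrib[symmetric])

lemma two_power_dvd_16_power: "(2::nat) ^ m dvd 16 ^ m"
  by (simp add: dvd_power_same)

section \<open>Block boundaries and drops of the slope\<close>

text \<open>Level boundaries are multiples of the block length, so no block straddles two
  levels.\<close>

lemma power_level_le_block_start:
  assumes "i \<ge> 1"
  shows "16 ^ level i \<le> block_start i"
proof -
  let ?K = "(2::nat) ^ level i"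
  have "?K * (16 ^ level i div ?K) \<le> ?K * (i div ?K)"
    using power_level_le[OF assms] by (intro mult_le_mono2 div_le_mono)
  then show ?thesis
    using two_power_dvd_16_power[of "level i"] by (simp add: block_start_def minus_mod_eq_mult_div)
qed

lemma block_start_add_le:
  "block_start i + 2 ^ level i \<le> 16 ^ Suc (level i)"
proof -
  let ?K = "(2::nat) ^ level i"
  have dvd: "?K dvd 16 ^ Suc (level i)"
    using two_power_dvd_16_power by (simp add: dvd_mult)
  then have "i div ?K < 16 ^ Suc (level i) div ?K"
    using less_power_Suc_level[of i]
    by (metis div_less_iff_less_mult dvd_div_mult_self pos2 zero_less_power)
  then have "?K * (i div ?K + 1) \<le> ?K * (16 ^ Suc (level i) div ?K)"
    by (intro mult_le_mono2) simp
  then show ?thesis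
    using dvd by (simp add: block_start_def minus_mod_eq_mult_div)
qed

lemma block_start_mono:
  assumes "l \<le> i"
  shows "block_start l \<le> block_start i"
proof (cases "level l = level i")
  case True
  then show ?thesis
    using assms by (simp add: block_start_def minus_mod_eq_mult_div div_le_mono)
next
  case False
  then have *: "level l < level i"
    using level_mono[OF assms] by simp
  then have "\<not> i < 16 ^ Suc (level l)"
    using level_le_iff by (metis linorder_not_le)
  then have "i \<ge> 1" by (cases i) auto
  have "block_start l \<le> 16 ^ Suc (level l)"
    using block_start_add_le[of l] by linarith
  also have "\<dots> \<le> 16 ^ level i"
    using * by (intro power_increasing) auto
  also have "\<dots> \<le> block_start i"
    using power_level_le_block_start \<open>i \<ge> 1\<close> by simp
  finally show ?thesis .
qed

text \<open>Within a level the curvature is constant, so a smaller slope at a later index means a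
  smaller residue, hence a later block. Between levels, the block of \<open>l\<close> ends before
  the level of \<open>i\<close> begins.\<close>

lemma block_start_descent:
  assumes "l < i" "slope i < slope l"
  shows "block_start l + 2 ^ level l \<le> block_start i"
proof (cases "level l = level i")
  case True
  let ?K = "(2::nat) ^ level i"
  have "i mod ?K < l mod ?K"
    using assms(2) True by (simp add: slope_def curv_def absc_def divide_less_cancel)
  then have "l div ?K \<noteq> i div ?K"
    using assms(1) by (metis add_less_cancel_left div_mult_mod_eq less_asym)
  then have "l div ?K + 1 \<le> i div ?K"
    using assms(1) div_le_mono[of l i ?K] by linarith
  then have "?K * (l div ?K + 1) \<le> ?K * (i div ?K)"
    by (rule mult_le_mono2)
  then show ?thesis
    using True by (simp add: block_start_def minus_mod_eq_mult_div)
next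
  case False
  then have "level l < level i"
    using level_mono[of l i] assms by simp
  then have "(16::nat) ^ Suc (level l) \<le> 16 ^ level i"
    by (intro power_increasing) auto
  then show ?thesis
    using block_start_add_le[of l] power_level_le_block_start[of i] assms(1) by linarith
qed

text \<open>Provides the potential for the alignment bound: across one block of level m,
  \<open>rise / 64\<^sup>2\<close> grows by at least \<open>1 / (64\<^sup>2 * 16 ^ m)\<close>, which
  is the squared curvature and so bounds the squared slope.\<close>

lemma slope_sq_le_rise_diff:
  assumes "l < i" "slope i < slope l"
  shows "(slope l)\<^sup>2 + rise (block_start l) / 64\<^sup>2 \<le> rise (block_start i) / 64\<^sup>2"
proof -
  have "(slope l)\<^sup>2 \<le> (curv l)\<^sup>2"
    using slope_le_curv slope_nonneg by (intro power_mono)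
  also have "\<dots> = (1 / 16 ^ level l) / 64\<^sup>2"
    by (simp add: curv_sq)
  also have "\<dots> \<le> (rise (block_start l + 2 ^ level l) - rise (block_start l)) / 64\<^sup>2"
    using rise_diff_ge[OF order_refl block_start_add_le] by (intro divide_right_mono) auto
  also have "\<dots> \<le> (rise (block_start i) - rise (block_start l)) / 64\<^sup>2"
    using rise_mono[OF block_start_descent[OF assms]] by (intro divide_right_mono) auto
  finally show ?thesis
    by (simp add: diff_divide_distrib)
qed

section \<open>Gaps of the menu\<close>

lemma menu_in_menus: "menu \<in> menus"
proof -
  have "0 \<le> menu i $ k \<and> menu i $ k \<le> 1" if "i \<ge> 1" for i k
  proof -
    have "0 \<le> curv i * (absc i)\<^sup>2" "curv i * (absc i)\<^sup>2 \<le> 1/64 * 1"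
      using curv_pos[of i] curv_le[of i] absc_pos[of i] absc_le_1[of i]
      by (simp, intro mult_mono power_le_one) auto
    then show ?thesis
      using that rise_nonneg[of i] rise_le[of i] absc_pos[of i] absc_le_1[of i] exhaust_2[of k]
      by (auto simp: menu_def)
  qed
  then show ?thesis
    by (simp add: menus_def menu_def)
qed

lemma absc_dist_same_level:
  assumes "level i = level j" "i mod 2 ^ level i \<noteq> j mod 2 ^ level i"
  shows "(1 / 2 ^ level i)\<^sup>2 \<le> (absc i - absc j)\<^sup>2"
proof -
  have "1 \<le> \<bar>real (i mod 2 ^ level i) - real (j mod 2 ^ level i)\<bar>"
    using assms(2) by linarith
  then have "1 / 2 ^ level i \<le> \<bar>absc i - absc j\<bar>"
    using assms(1) by (simp add: absc_def diff_divide_distrib[symmetric] divide_right_mono)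
  then show ?thesis
    by (metis abs_le_square_iff abs_of_nonneg zero_le_divide_1_iff zero_le_numeral zero_le_power)
qed

lemma menu_diff_inner_ge:
  assumes "j < i"
  shows "1 / (256 * 16 ^ level i) \<le> (menu i - menu j) \<bullet> slope_vec (slope i)"
proof (cases "j = 0")
  case True
  have "1 / (256 * 16 ^ level i) \<le> (1 / 2 :: real)"
  proof -
    have "(1::real) \<le> 16 ^ level i" by simp
    then have "(2::real) \<le> 256 * 16 ^ level i" by linarith
    then show ?thesis by (intro divide_left_mono) auto
  qed
  also have "\<dots> \<le> 1 / 2 + rise i / 64 + curv i * (absc i)\<^sup>2 / 2"
    using rise_nonneg[of i] curv_pos[of i] by simp
  also have "\<dots> = (menu i - menu j) \<bullet> slope_vec (slope i)"
    using assms True by (simp add: inner_real2 menu_def slope_def power2_eq_square algebra_simps)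
  finally show ?thesis .
next
  case False
  define r where "r = (rise i - rise j) / 64"
  \<comment> \<open>Completing the square yields three nonnegative terms: height gained, distance
    along the parabola of \<open>i\<close>, and loss of curvature from \<open>j\<close> to
    \<open>i\<close>.\<close>
  have eq: "(menu i - menu j) \<bullet> slope_vec (slope i) =
      r + curv i * (absc i - absc j)\<^sup>2 / 2 + (curv j - curv i) * (absc j)\<^sup>2 / 2"
    using assms False
    by (simp add: inner_real2 menu_def slope_def r_def power2_eq_square field_simps)
  have r0: "0 \<le> r"
    using rise_mono[of j i] assms by (simp add: r_def)
  have cs: "curv i * (1 / 2 ^ level i)\<^sup>2 = 1 / (64 * 16 ^ level i)"
    by (simp add: curv_def power2_eq_square power_mult_distrib[symmetric])
  have "1 / (256 * 16 ^ level i) \<le> r + curv i * (absc i - absc j)\<^sup>2 / 2 + (curv j - curv i) * (absc j)\<^sup>2 / 2"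
  proof (cases "level i = level j")
    case True
    then have "curv j = curv i" by (simp add: curv_def)
    have "1 / (128 * 16 ^ level i) \<le> r + curv i * (absc i - absc j)\<^sup>2 / 2"
    \<comment> \<open>Equal residues put \<open>j\<close> at least one full block before
      \<open>i\<close>, so the height gained suffices; otherwise the abscissas differ by at least
      one step.\<close>
    proof (cases "i mod 2 ^ level i = j mod 2 ^ level i")
      case True
      then have "2 ^ level i dvd i - j"
        using assms by (simp add: mod_eq_dvd_iff_nat)
      then have "2 ^ level i \<le> i - j"
        using assms by (intro dvd_imp_le) auto
      then have "1 / 16 ^ level i \<le> rise i - rise j"
        using assms less_power_Suc_level[of i] by (intro rise_diff_ge) auto
      then have "(1 / 16 ^ level i) / 64 \<le> r"
        unfolding r_def by (intro divide_right_mono) auto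
      moreover have "0 \<le> curv i * (absc i - absc j)\<^sup>2 / 2"
        using curv_pos[of i] by simp
      moreover have "1 / (128 * 16 ^ level i) \<le> ((1::real) / 16 ^ level i) / 64"
        unfolding divide_divide_eq_left by (intro divide_left_mono) auto
      ultimately show ?thesis by linarith
    next
      case False
      have "1 / (128 * 16 ^ level i) = curv i * (1 / 2 ^ level i)\<^sup>2 / 2"
        unfolding cs by simp
      also have "\<dots> \<le> curv i * (absc i - absc j)\<^sup>2 / 2"
        using absc_dist_same_level[OF \<open>level i = level j\<close> False] curv_pos[of i]
        by (intro divide_right_mono mult_left_mono) auto
      finally show ?thesis using r0 by linarith
    qed
    moreover have "1 / (256 * 16 ^ level i) \<le> (1::real) / (128 * 16 ^ level i)"
      by (intro divide_left_mono) auto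
    ultimately show ?thesis
      using \<open>curv j = curv i\<close> by simp
  next
    case False
    \<comment> \<open>Across levels the abscissas may coincide and the height gained may be too
      small. The drop of curvature by a factor of at least 4 leaves a surplus of
      \<open>3 * curv i * (absc j)\<^sup>2 / 2\<close>.\<close>
    then have "Suc (level j) \<le> level i"
      using level_mono[of j i] assms by simp
    then have "(4::real) ^ Suc (level j) \<le> 4 ^ level i"
      by (intro power_increasing) auto
    then have c4: "4 * curv i \<le> curv j"
      by (simp add: curv_def field_simps)
    have "1 / (256 * 16 ^ level i) = curv i * (1 / 2 ^ level i)\<^sup>2 / 4"
      unfolding cs by simp
    also have "\<dots> \<le> curv i * (absc i)\<^sup>2 / 4"
      using absc_ge[of i] curv_pos[of i]
      by (intro divide_right_mono mult_left_mono power_mono) auto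
    also have "\<dots> \<le> curv i * ((absc i - absc j)\<^sup>2 / 2 + 3 * (absc j)\<^sup>2 / 2)"
    proof -
      \<comment> \<open>The minimum over \<open>absc j\<close> is attained at \<open>absc j = absc i / 4\<close>.\<close>
      have "(absc i - absc j)\<^sup>2 / 2 + 3 * (absc j)\<^sup>2 / 2 - (absc i)\<^sup>2 / 4
          = 2 * (absc j - absc i / 4)\<^sup>2 + (absc i)\<^sup>2 / 8"
        by (simp add: power2_eq_square field_simps)
      then have "(absc i)\<^sup>2 / 4 \<le> (absc i - absc j)\<^sup>2 / 2 + 3 * (absc j)\<^sup>2 / 2"
        by (smt (verit) zero_le_power2 divide_nonneg_pos)
      then show ?thesis
        using mult_left_mono[OF _ less_imp_le[OF curv_pos[of i]]] by (metis times_divide_eq_right)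
    qed
    also have "\<dots> = curv i * (absc i - absc j)\<^sup>2 / 2 + (4 * curv i - curv i) * (absc j)\<^sup>2 / 2"
      by (simp add: field_simps)
    also have "\<dots> \<le> curv i * (absc i - absc j)\<^sup>2 / 2 + (curv j - curv i) * (absc j)\<^sup>2 / 2"
      using c4 by (intro add_left_mono divide_right_mono mult_right_mono) auto
    finally show ?thesis using r0 by linarith
  qed
  then show ?thesis using eq by simp
qed

text \<open>\<open>16 ^ level i <= i\<close> turns the level bound into a harmonic one; the constant
  halves since the 1-norm of the normal is at most 2.\<close>

lemma menu_gap_ge:
  assumes "i \<ge> 1"
  shows "(1 / 512) / real i
    \<le> menu_gap_i (\<lambda>i. slope_vec (slope i)) menu i / l1norm (slope_vec (slope i))"
proof -
  let ?g = "menu_gap_i (\<lambda>i. slope_vec (slope i)) menu i"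
  have "real (16 ^ level i) \<le> real i"
    using power_level_le[OF assms] by (simp only: of_nat_le_iff)
  then have "(1 / 256) / real i \<le> 1 / (256 * 16 ^ level i)"
    using assms by (simp add: frac_le)
  also have "\<dots> \<le> ?g"
    unfolding menu_gap_i_def using assms menu_diff_inner_ge
    by (subst Min_ge_iff) (auto simp: lessThan_empty_iff)
  finally have g: "(1 / 256) / real i \<le> ?g" .
  have "(1 / 512) / real i = (1 / 256) / real i / 2"
    by simp
  also have "\<dots> \<le> ?g / (1 + slope i)"
    using g slope_nonneg[of i] slope_le_1[of i] by (intro frac_le) (auto intro: order_trans[OF _ g])
  finally show ?thesis
    using slope_nonneg by (simp add: l1norm_slope_vec)
qed

theorem theorem3p3:
  shows "\<exists>X :: nat \<Rightarrow> real^2.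
           (\<forall>i\<ge>1. X i \<noteq> 0 \<and> (\<forall>k. 0 \<le> X i $ k \<and> X i $ k \<le> 1)) \<and>
           AlignGap X \<le> 6 \<and> MenuGap X = \<infinity>"
proof (intro exI conjI)
  let ?X = "\<lambda>i. slope_vec (slope i)"
  have "0 \<le> ?X i $ k \<and> ?X i $ k \<le> 1" for i k
    using exhaust_2[of k] slope_nonneg[of i] slope_le_1[of i] by auto
  then show "\<forall>i\<ge>1. ?X i \<noteq> 0 \<and> (\<forall>k. 0 \<le> ?X i $ k \<and> ?X i $ k \<le> 1)"
    by simp
  \<comment> \<open>The potential is at most \<open>32 / 64\<^sup>2\<close>; the generous bound 4 is
    chosen to make the total 6.\<close>
  have "AlignGap ?X \<le> ereal (2 + 4)"
  proof (rule AlignGap_slope_vec_le[where W = "\<lambda>i. rise (block_start i) / 64\<^sup>2"])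
    show "rise (block_start i) / 64\<^sup>2 \<le> 4" for i
      using rise_le[of "block_start i"] by simp
    show "mono (\<lambda>i. rise (block_start i) / 64\<^sup>2)"
      using rise_mono block_start_mono by (intro monoI divide_right_mono) auto
  qed (auto simp: slope_nonneg slope_le_1 rise_nonneg intro: slope_sq_le_rise_diff[simplified])
  then show "AlignGap ?X \<le> 6" by simp
  show "MenuGap ?X = \<infinity>"
    using menu_in_menus menu_gap_ge by (intro MenuGap_eq_PInfty[of menu "1 / 512"]) auto
qed

end
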